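(* Let $k_1,k_2\ge1$ be integers. For all $n\ge k_1+k_2$, $$P_{q,\theta}(\widetilde W_L=n)=\widetilde P^{(1)}_{q,L}(n)+\widetilde P^{(0)}_{q,L}(n),$$ where $$\widetilde P^{(1)}_{q,L}(n)=\sum_{i=k_2}^{n-k_1}\theta^{n-i}q^{ik_1}\prod_{j=1}^{i}(1-\theta q^{j-1})\sum_{s=1}^{i}\Big[\overline E_{q,0,0}^{k_1,\infty}(n-k_1-i,i,s)+\overline F_{q,0,0}^{k_1,\infty}(n-k_1-i,i,s)\Big]$$ and $$\widetilde P^{(0)}_{q,L}(n)=\theta^{n-k_2}\prod_{j=1}^{k_2}(1-\theta q^{j-1})\sum_{s=1}^{k_2}\Big[K_{q,k_1,0}(n-k_2,k_2,s)+L_{q,k_1,0}(n-k_2,k_2,s)\Big].$$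
   Context: Model: fix reals $0\le\theta\le1$ and $0<q<1$. $(X_j)_{j\ge1}$ is a sequence of $\{0,1\}$-valued random variables (1 = success, 0 = failure) with law $P_{q,\theta}$ such that, conditionally on $X_1,\dots,X_{j-1}$ containing exactly $i-1$ zeros, $X_j=0$ with probability $1-\theta q^{i-1}$ and $X_j=1$ with probability $\theta q^{i-1}$. Conventions: $0^0=1$, empty products are 1, empty sums are 0. Waiting times: $T_1$ is the least $n\ge k_1$ with $X_{n-k_1+1}=\dots=X_n=1$; $N_0$ is the trial at which the $k_2$-th failure (in total) occurs ($\infty$ if it does not occur). $\widetilde W_L=\max(T_1,N_0)$ (run quota on successes, frequency quota on failures, later case); $\widetilde P^{(1)}_{q,L}(n)=P_{q,\theta}(T_1=n,\ N_0<n)$ and $\widetilde P^{(0)}_{q,L}(n)=P_{q,\theta}(N_0=n,\ T_1<n)$. $S_{r,s}^{k}$ denotes the set of $s$-tuples of positive integers with sum $r$ and maximum $>k$ (for $k=0$ the maximum condition is vacuous, and $S_{0,0}^0$ consists of the empty tuple). Combinatorial sums, for integers $m,r$ and $s\ge1$: - $\overline E_{q,0,0}^{k_1,\infty}(m,r,s)=\sum q^{\sum_{j=1}^{s-1}(y_1+\dots+y_j)x_j}$ over $(x_1,\dots,x_{s-1})\in S_{m,s-1}^0$ with all $x_j<k_1$ and $(y_1,\dots,y_s)\in S_{r,s}^0$; - $\overline F_{q,0,0}^{k_1,\infty}(m,r,s)=\sum q^{\sum_{j=2}^{s}(y_1+\dots+y_{j-1})x_j}$ over $(x_1,\dots,x_s)\in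 S_{m,s}^0$ with all $x_j<k_1$ and $(y_1,\dots,y_s)\in S_{r,s}^0$; - $K_{q,k_1,0}(m,r,s)=\sum q^{\sum_{j=1}^{s-1}(y_1+\dots+y_j)x_j}$ over $(x_1,\dots,x_{s-1})\in S_{m,s-1}^{k_1-1}$, $(y_1,\dots,y_s)\in S_{r,s}^0$; - $L_{q,k_1,0}(m,r,s)=\sum q^{\sum_{j=2}^{s}(y_1+\dots+y_{j-1})x_j}$ over $(x_1,\dots,x_s)\in S_{m,s}^{k_1-1}$, $(y_1,\dots,y_s)\in S_{r,s}^0$. *)

theory Defs
  imports "HOL-Probability.Probability" "HOL-Library.Extended_Nat"
begin

text \<open>
  The Bernoulli-type sequence with geometrically varying success probability. The index \<open>0\<close> is
  unused: trials are \<open>X 1, X 2, \<dots>\<close>. The law is given through the conditional distribution of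
  \<open>X j\<close> given every outcome \<open>a\<close> of positive probability of the previous trials; it depends on
  \<open>a\<close> only through the number of its zeros (this number is \<open>i - 1\<close> in the usual notation).
\<close>

locale q_bernoulli_seq = prob_space M
  for M :: "'a measure" +
  fixes X :: "nat \<Rightarrow> 'a \<Rightarrow> nat" and q \<theta> :: real
  assumes random_variable_X: "j \<ge> 1 \<Longrightarrow> random_variable (count_space UNIV) (X j)"
    and X_binary: "j \<ge> 1 \<Longrightarrow> \<omega> \<in> space M \<Longrightarrow> X j \<omega> \<in> {0, 1}"
    and cond_failure:
      "\<lbrakk>j \<ge> 1; a \<in> {1..<j} \<rightarrow> {0, 1};
        \<P>(\<omega> in M. \<forall>l\<in>{1..<j}. X l \<omega> = a l) > 0\<rbrakk> \<Longrightarrow>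
       cond_prob M (\<lambda>\<omega>. X j \<omega> = 0) (\<lambda>\<omega>. \<forall>l\<in>{1..<j}. X l \<omega> = a l)
         = 1 - \<theta> * q ^ card {l \<in> {1..<j}. a l = 0}"
    and cond_success:
      "\<lbrakk>j \<ge> 1; a \<in> {1..<j} \<rightarrow> {0, 1};
        \<P>(\<omega> in M. \<forall>l\<in>{1..<j}. X l \<omega> = a l) > 0\<rbrakk> \<Longrightarrow>
       cond_prob M (\<lambda>\<omega>. X j \<omega> = 1) (\<lambda>\<omega>. \<forall>l\<in>{1..<j}. X l \<omega> = a l)
         = \<theta> * q ^ card {l \<in> {1..<j}. a l = 0}"

text \<open>Waiting times are \<open>\<infinity>\<close> (the infimum of the empty set of \<open>enat\<close>) if the event never occurs.\<close>

definition success_run_time :: "(nat \<Rightarrow> 'a \<Rightarrow> nat) \<Rightarrow> nat \<Rightarrow> 'a \<Rightarrow> enat" where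
  "success_run_time X k \<omega> = Inf (enat ` {n. n \<ge> k \<and> (\<forall>j\<in>{n - k + 1..n}. X j \<omega> = 1)})"

definition failure_time :: "(nat \<Rightarrow> 'a \<Rightarrow> nat) \<Rightarrow> nat \<Rightarrow> 'a \<Rightarrow> enat" where
  "failure_time X k \<omega> =
     Inf (enat ` {n. n \<ge> 1 \<and> X n \<omega> = 0 \<and> card {j \<in> {1..n}. X j \<omega> = 0} = k})"

definition later_time :: "(nat \<Rightarrow> 'a \<Rightarrow> nat) \<Rightarrow> nat \<Rightarrow> nat \<Rightarrow> 'a \<Rightarrow> enat" where
  "later_time X k1 k2 \<omega> = max (success_run_time X k1 \<omega>) (failure_time X k2 \<omega>)"

definition P1_L :: "'a measure \<Rightarrow> (nat \<Rightarrow> 'a \<Rightarrow> nat) \<Rightarrow> nat \<Rightarrow> nat \<Rightarrow> nat \<Rightarrow> real" where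
  "P1_L M X k1 k2 n =
     \<P>(\<omega> in M. success_run_time X k1 \<omega> = enat n \<and> failure_time X k2 \<omega> < enat n)"

definition P0_L :: "'a measure \<Rightarrow> (nat \<Rightarrow> 'a \<Rightarrow> nat) \<Rightarrow> nat \<Rightarrow> nat \<Rightarrow> nat \<Rightarrow> real" where
  "P0_L M X k1 k2 n =
     \<P>(\<omega> in M. failure_time X k2 \<omega> = enat n \<and> success_run_time X k1 \<omega> < enat n)"

text \<open>
  An \<open>s\<close>-tuple is an extensional function on \<open>{1..s}\<close>, so that the unique \<open>0\<close>-tuple is the
  empty one and all the sets below are finite. \<open>S_set k r s\<close> is $S_{r,s}^k$; the maximum of
  the empty tuple does not exceed any \<open>k > 0\<close>.
\<close>

definition S_set :: "nat \<Rightarrow> nat \<Rightarrow> nat \<Rightarrow> (nat \<Rightarrow> nat) set" where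
  "S_set k r s =
     {x \<in> {1..s} \<rightarrow>\<^sub>E {1..}. (\<Sum>j=1..s. x j) = r \<and> (k = 0 \<or> (\<exists>j\<in>{1..s}. x j > k))}"

definition E_bar :: "real \<Rightarrow> nat \<Rightarrow> nat \<Rightarrow> nat \<Rightarrow> nat \<Rightarrow> real" where
  "E_bar q k1 m r s =
     (\<Sum>x\<in>{x \<in> S_set 0 m (s - 1). \<forall>j\<in>{1..s - 1}. x j < k1}. \<Sum>y\<in>S_set 0 r s.
        q ^ (\<Sum>j=1..s - 1. (\<Sum>l=1..j. y l) * x j))"

definition F_bar :: "real \<Rightarrow> nat \<Rightarrow> nat \<Rightarrow> nat \<Rightarrow> nat \<Rightarrow> real" where
  "F_bar q k1 m r s =
     (\<Sum>x\<in>{x \<in> S_set 0 m s. \<forall>j\<in>{1..s}. x j < k1}. \<Sum>y\<in>S_set 0 r s.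
        q ^ (\<Sum>j=2..s. (\<Sum>l=1..j - 1. y l) * x j))"

definition K_sum :: "real \<Rightarrow> nat \<Rightarrow> nat \<Rightarrow> nat \<Rightarrow> nat \<Rightarrow> real" where
  "K_sum q k1 m r s =
     (\<Sum>x\<in>S_set (k1 - 1) m (s - 1). \<Sum>y\<in>S_set 0 r s.
        q ^ (\<Sum>j=1..s - 1. (\<Sum>l=1..j. y l) * x j))"

definition L_sum :: "real \<Rightarrow> nat \<Rightarrow> nat \<Rightarrow> nat \<Rightarrow> nat \<Rightarrow> real" where
  "L_sum q k1 m r s =
     (\<Sum>x\<in>S_set (k1 - 1) m s. \<Sum>y\<in>S_set 0 r s.
        q ^ (\<Sum>j=2..s. (\<Sum>l=1..j - 1. y l) * x j))"

end

theory Submission imports Defs begin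

text \<open>
  Call trial \<open>m + r\<close> a good failure if it is the \<open>r\<close>-th failure and the \<open>m\<close> successes
  before it contain no run of length \<open>k\<close>. Both events of the theorem reduce to good failures.
  If the first run of \<open>k1\<close> successes is completed at trial \<open>n\<close>, then trial \<open>n - k1\<close> is a
  failure, hence a good one, and the last \<open>k1\<close> trials are successes; summing over the number \<open>i\<close>
  of failures gives the first probability (\<open>first_run_failure_end\<close>). If the \<open>k2\<close>-th failure
  occurs at trial \<open>n\<close> after some run of \<open>k1\<close> successes, then \<open>n\<close> is a good failure for the
  void bound \<open>k = n + 1\<close> but not for \<open>k = k1\<close>; the second probability is therefore a difference
  (\<open>failure_end_unrestricted_diff\<close>), and \<open>K_sum\<close> and \<open>L_sum\<close> are the corresponding
  differences of \<open>E_bar\<close> and \<open>F_bar\<close> (\<open>K_sum_diff\<close>, \<open>L_sum_diff\<close>).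

  It remains to find the probability \<open>p m r\<close> of a good failure. Removing the last failure and
  the \<open>z < k\<close> successes directly before it leaves a good failure with parameters \<open>m - z\<close> and
  \<open>r - 1\<close>, or the empty sequence. Each of these successes has conditional probability
  \<open>\<theta> * q ^ (r - 1)\<close>, so
  \<open>p m r = (\<Sum>z. (\<theta> * q ^ (r - 1)) ^ z * (1 - \<theta> * q ^ (r - 1)) * p (m - z) (r - 1))\<close>.
  The formula sorts the same sequences differently, by the lengths \<open>x\<close> of their maximal blocks of
  successes and \<open>y\<close> of their maximal blocks of failures: \<open>E_bar\<close> covers the sequences that start
  with a failure and \<open>F_bar\<close> those that start with a success. The two descriptions are
  matched through their recurrences. Removing the last block of successes and the last block of
  failures gives a recurrence for \<open>E_bar + F_bar\<close>, summed over the number of blocks, that refers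
  to all smaller numbers of failures (\<open>block_gf_blocks\<close>). Subtracting this recurrence at \<open>r\<close> from
  the one at \<open>r + 1\<close> leaves exactly the recurrence of \<open>p\<close> (\<open>block_gf_Suc\<close>,
  \<open>prob_failure_end\<close>), up to the factor \<open>\<theta> ^ m * (\<Prod>j=1..r. 1 - \<theta> * q ^ (j - 1))\<close>.
\<close>

section \<open>Compositions with bounded parts\<close>

definition bounded_comps :: "nat \<Rightarrow> nat \<Rightarrow> nat \<Rightarrow> (nat \<Rightarrow> nat) set" where
  "bounded_comps k m s = {x \<in> S_set 0 m s. \<forall>j\<in>{1..s}. x j < k}"

lemma part_le_total:
  assumes "x \<in> S_set 0 m s" "j \<in> {1..s}"
  shows "x j \<le> m"
proof -
  have "x j \<le> (\<Sum>j=1..s. x j)"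
    using assms(2) by (intro member_le_sum) auto
  thus ?thesis using assms(1) by (simp add: S_set_def)
qed

lemma finite_S_set: "finite (S_set k m s)"
proof (rule finite_subset)
  show "S_set k m s \<subseteq> {1..s} \<rightarrow>\<^sub>E {..m}"
  proof
    fix x assume x: "x \<in> S_set k m s"
    hence "x \<in> S_set 0 m s" by (auto simp: S_set_def)
    hence "\<forall>j\<in>{1..s}. x j \<le> m" using part_le_total by blast
    thus "x \<in> {1..s} \<rightarrow>\<^sub>E {..m}" using x by (auto simp: S_set_def PiE_iff)
  qed
qed (simp add: finite_PiE)

text \<open>
  Parts are at most the total, so a bound beyond the total is void. The sums over unrestricted
  tuples are thus instances of the sums over bounded ones.
\<close>

lemma bounded_comps_large_bound:
  assumes "m < k"
  shows "bounded_comps k m s = S_set 0 m s"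
proof -
  have "x j < k" if "x \<in> S_set 0 m s" "j \<in> {1..s}" for x j
    using part_le_total[OF that] assms by simp
  thus ?thesis unfolding bounded_comps_def by blast
qed

lemma bounded_comps_0: "bounded_comps k m 0 = (if m = 0 then {\<lambda>_. undefined} else {})"
  by (auto simp: bounded_comps_def S_set_def)

lemma S_set_0_parts: "S_set 0 m 0 = (if m = 0 then {\<lambda>_. undefined} else {})"
  by (auto simp: S_set_def)

lemma S_set_empty:
  assumes "m < s"
  shows "S_set k m s = {}"
proof -
  have "s \<le> (\<Sum>j=1..s. x j)" if "x \<in> {1..s} \<rightarrow>\<^sub>E {1..}" for x :: "nat \<Rightarrow> nat"
  proof -
    have "(\<Sum>j=1..s. 1) \<le> (\<Sum>j=1..s. x j)"
      using that by (intro sum_mono) (auto simp: PiE_iff)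
    thus ?thesis by simp
  qed
  hence "s \<le> m" if "x \<in> S_set k m s" for x
    using that unfolding S_set_def by blast
  thus ?thesis using assms by (meson equals0I leD)
qed

text \<open>
  The last part \<open>u\<close> is split off. Applied to both tuples of a block decomposition, this
  yields the recurrences of \<open>E_bar\<close> and \<open>F_bar\<close>.
\<close>

lemma sum_bounded_comps_Suc:
  fixes f :: "(nat \<Rightarrow> nat) \<Rightarrow> real"
  shows "(\<Sum>x\<in>bounded_comps k m (Suc s). f x) =
    (\<Sum>u | u \<in> {1..m} \<and> u < k. \<Sum>x\<in>bounded_comps k (m - u) s. f (x(Suc s := u)))"
proof -
  have "(\<Sum>x\<in>bounded_comps k m (Suc s). f x) =
    (\<Sum>(u, x)\<in>(SIGMA u:{u \<in> {1..m}. u < k}. bounded_comps k (m - u) s). f (x(Suc s := u)))"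
  proof (rule sum.reindex_bij_witness[where
      j = "\<lambda>x. (x (Suc s), x(Suc s := undefined))" and i = "\<lambda>(u, x). x(Suc s := u)"])
    fix x assume x: "x \<in> bounded_comps k m (Suc s)"
    have le: "x (Suc s) \<le> m"
      using x part_le_total[of x m "Suc s" "Suc s"] by (simp add: bounded_comps_def)
    have "(\<Sum>j=1..Suc s. x j) = m" using x by (simp add: bounded_comps_def S_set_def)
    hence "(\<Sum>j=1..s. x j) = m - x (Suc s)" by simp
    moreover have "(\<Sum>j=1..s. (x(Suc s := undefined)) j) = (\<Sum>j=1..s. x j)"
      by (intro sum.cong) auto
    ultimately show "(x (Suc s), x(Suc s := undefined))
        \<in> (SIGMA u:{u \<in> {1..m}. u < k}. bounded_comps k (m - u) s)"
      using x le by (auto simp: bounded_comps_def S_set_def PiE_iff extensional_def)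
  next
    fix p assume p: "p \<in> (SIGMA u:{u \<in> {1..m}. u < k}. bounded_comps k (m - u) s)"
    obtain u x where [simp]: "p = (u, x)" by (cases p)
    have x: "x \<in> bounded_comps k (m - u) s" and u: "1 \<le> u" "u \<le> m" "u < k" using p by auto
    have "(\<Sum>j=1..s. (x(Suc s := u)) j) = (\<Sum>j=1..s. x j)"
      by (intro sum.cong) auto
    hence "(\<Sum>j=1..Suc s. (x(Suc s := u)) j) = m"
      using x u by (simp add: bounded_comps_def S_set_def)
    thus "(case p of (u, x) \<Rightarrow> x(Suc s := u)) \<in> bounded_comps k m (Suc s)"
      using x u by (auto simp: bounded_comps_def S_set_def PiE_iff extensional_def le_Suc_eq)
    have "x (Suc s) = undefined"
      using x by (auto simp: bounded_comps_def S_set_def PiE_iff extensional_def)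
    thus "(\<lambda>x. (x (Suc s), x(Suc s := undefined))) (case p of (u, x) \<Rightarrow> x(Suc s := u)) = p"
      by (simp add: fun_eq_iff)
  qed (auto simp: fun_eq_iff)
  also have "\<dots> = (\<Sum>u | u \<in> {1..m} \<and> u < k. \<Sum>x\<in>bounded_comps k (m - u) s. f (x(Suc s := u)))"
    by (subst sum.Sigma) (auto simp: bounded_comps_def finite_S_set)
  finally show ?thesis .
qed

lemma sum_S_set_Suc:
  fixes f :: "(nat \<Rightarrow> nat) \<Rightarrow> real"
  shows "(\<Sum>y\<in>S_set 0 r (Suc s). f y) =
    (\<Sum>v=1..r. \<Sum>y\<in>S_set 0 (r - v) s. f (y(Suc s := v)))"
proof -
  have "{v. v \<in> {1..r} \<and> v < Suc r} = {1..r}" by auto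
  thus ?thesis
    using sum_bounded_comps_Suc[of f "Suc r" r s] by (simp add: bounded_comps_large_bound)
qed

section \<open>Recurrences for the combinatorial sums\<close>

lemma E_bar_alt:
  "E_bar q k m r s = (\<Sum>x\<in>bounded_comps k m (s - 1). \<Sum>y\<in>S_set 0 r s.
     q ^ (\<Sum>j=1..s - 1. (\<Sum>l=1..j. y l) * x j))"
  by (simp add: E_bar_def bounded_comps_def)

lemma F_bar_alt:
  "F_bar q k m r s = (\<Sum>x\<in>bounded_comps k m s. \<Sum>y\<in>S_set 0 r s.
     q ^ (\<Sum>j=2..s. (\<Sum>l=1..j - 1. y l) * x j))"
  by (simp add: F_bar_def bounded_comps_def)

lemma E_bar_1: "E_bar q k m r 1 = (if m = 0 \<and> 1 \<le> r then 1 else 0)"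
proof -
  have "E_bar q k m r 1 = (if m = 0 then \<Sum>y\<in>S_set 0 r (Suc 0). 1 else 0)"
    by (simp add: E_bar_alt bounded_comps_0)
  also have "(\<Sum>y\<in>S_set 0 r (Suc 0). 1::real) = (\<Sum>v=1..r. if v = r then 1 else 0)"
    unfolding sum_S_set_Suc by (intro sum.cong) (auto simp: S_set_0_parts)
  finally show ?thesis by simp
qed

lemma F_bar_0: "F_bar q k m r 0 = (if m = 0 \<and> r = 0 then 1 else 0)"
  by (simp add: F_bar_alt bounded_comps_0 S_set_0_parts)

lemma E_bar_empty: "r < s \<Longrightarrow> E_bar q k m r s = 0"
  by (simp add: E_bar_alt S_set_empty)

lemma F_bar_empty: "r < s \<Longrightarrow> F_bar q k m r s = 0"
  by (simp add: F_bar_alt S_set_empty)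

text \<open>
  Removing the last block of \<open>u\<close> successes and the last block of \<open>v\<close> failures: the removed
  successes come after \<open>r - v\<close> failures each, which accounts for the factor.
\<close>

lemma E_bar_Suc:
  "E_bar q k m r (Suc (Suc s)) = (\<Sum>u | u \<in> {1..m} \<and> u < k. \<Sum>v=1..r.
     q ^ ((r - v) * u) * E_bar q k (m - u) (r - v) (Suc s))"
proof -
  have expo: "(\<Sum>j=1..Suc s. (\<Sum>l=1..j. (y(Suc (Suc s) := v)) l) * (x(Suc s := u)) j) =
      (r - v) * u + (\<Sum>j=1..s. (\<Sum>l=1..j. y l) * x j)"
    if "y \<in> S_set 0 (r - v) (Suc s)" for x y u v
  proof -
    have *: "(\<Sum>l=1..j. (y(Suc (Suc s) := v)) l) = (\<Sum>l=1..j. y l)" if "j \<le> Suc s" for j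
      using that by (intro sum.cong) auto
    have "(\<Sum>j=1..s. (\<Sum>l=1..j. (y(Suc (Suc s) := v)) l) * (x(Suc s := u)) j) =
        (\<Sum>j=1..s. (\<Sum>l=1..j. y l) * x j)"
      by (intro sum.cong refl) (subst *, auto)
    moreover have "(\<Sum>l=1..Suc s. y l) = r - v" using that by (simp add: S_set_def)
    ultimately show ?thesis using *[of "Suc s"] by simp
  qed
  have "E_bar q k m r (Suc (Suc s)) =
     (\<Sum>u | u \<in> {1..m} \<and> u < k. \<Sum>x\<in>bounded_comps k (m - u) s. \<Sum>v=1..r.
        \<Sum>y\<in>S_set 0 (r - v) (Suc s). q ^ (\<Sum>j=1..Suc s. (\<Sum>l=1..j. (y(Suc (Suc s) := v)) l)
          * (x(Suc s := u)) j))"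
    unfolding E_bar_alt diff_Suc_1 by (simp only: sum_bounded_comps_Suc sum_S_set_Suc)
  also have "\<dots> = (\<Sum>u | u \<in> {1..m} \<and> u < k. \<Sum>x\<in>bounded_comps k (m - u) s. \<Sum>v=1..r.
        \<Sum>y\<in>S_set 0 (r - v) (Suc s). q ^ ((r - v) * u) * q ^ (\<Sum>j=1..s. (\<Sum>l=1..j. y l) * x j))"
    by (intro sum.cong refl) (simp only: expo power_add)
  also have "\<dots> = (\<Sum>u | u \<in> {1..m} \<and> u < k. \<Sum>v=1..r. \<Sum>x\<in>bounded_comps k (m - u) s.
        \<Sum>y\<in>S_set 0 (r - v) (Suc s). q ^ ((r - v) * u) * q ^ (\<Sum>j=1..s. (\<Sum>l=1..j. y l) * x j))"
    by (intro sum.cong refl sum.swap)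
  also have "\<dots> = (\<Sum>u | u \<in> {1..m} \<and> u < k. \<Sum>v=1..r.
     q ^ ((r - v) * u) * E_bar q k (m - u) (r - v) (Suc s))"
    by (simp add: E_bar_alt sum_distrib_left)
  finally show ?thesis .
qed

lemma F_bar_Suc:
  "F_bar q k m r (Suc s) = (\<Sum>u | u \<in> {1..m} \<and> u < k. \<Sum>v=1..r.
     q ^ ((r - v) * u) * F_bar q k (m - u) (r - v) s)"
proof -
  have expo: "(\<Sum>j=2..Suc s. (\<Sum>l=1..j - 1. (y(Suc s := v)) l) * (x(Suc s := u)) j) =
      (r - v) * u + (\<Sum>j=2..s. (\<Sum>l=1..j - 1. y l) * x j)"
    if y: "y \<in> S_set 0 (r - v) s" for x y u v
  proof (cases "s = 0")
    case True
    \<comment> \<open>No failure precedes the first block of successes: \<open>y\<close> is the empty tuple, so \<open>r - v = 0\<close>.\<close>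
    thus ?thesis using y by (simp add: S_set_def)
  next
    case False
    have *: "(\<Sum>l=1..j - 1. (y(Suc s := v)) l) = (\<Sum>l=1..j - 1. y l)" if "j \<le> Suc s" for j
      using that by (intro sum.cong) auto
    have "(\<Sum>j=2..s. (\<Sum>l=1..j - 1. (y(Suc s := v)) l) * (x(Suc s := u)) j) =
        (\<Sum>j=2..s. (\<Sum>l=1..j - 1. y l) * x j)"
      by (intro sum.cong refl) (subst *, auto)
    moreover have "(\<Sum>l=1..s. y l) = r - v" using y by (simp add: S_set_def)
    ultimately show ?thesis using *[of "Suc s"] False by simp
  qed
  have "F_bar q k m r (Suc s) =
     (\<Sum>u | u \<in> {1..m} \<and> u < k. \<Sum>x\<in>bounded_comps k (m - u) s. \<Sum>v=1..r.
        \<Sum>y\<in>S_set 0 (r - v) s. q ^ (\<Sum>j=2..Suc s. (\<Sum>l=1..j - 1. (y(Suc s := v)) l)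
          * (x(Suc s := u)) j))"
    unfolding F_bar_alt by (simp only: sum_bounded_comps_Suc sum_S_set_Suc)
  also have "\<dots> = (\<Sum>u | u \<in> {1..m} \<and> u < k. \<Sum>x\<in>bounded_comps k (m - u) s. \<Sum>v=1..r.
        \<Sum>y\<in>S_set 0 (r - v) s. q ^ ((r - v) * u) * q ^ (\<Sum>j=2..s. (\<Sum>l=1..j - 1. y l) * x j))"
    by (intro sum.cong refl) (simp only: expo power_add)
  also have "\<dots> = (\<Sum>u | u \<in> {1..m} \<and> u < k. \<Sum>v=1..r. \<Sum>x\<in>bounded_comps k (m - u) s.
        \<Sum>y\<in>S_set 0 (r - v) s. q ^ ((r - v) * u) * q ^ (\<Sum>j=2..s. (\<Sum>l=1..j - 1. y l) * x j))"
    by (intro sum.cong refl sum.swap)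
  also have "\<dots> = (\<Sum>u | u \<in> {1..m} \<and> u < k. \<Sum>v=1..r.
     q ^ ((r - v) * u) * F_bar q k (m - u) (r - v) s)"
    by (simp add: F_bar_alt sum_distrib_left)
  finally show ?thesis .
qed

text \<open>
  The empty sequence, which belongs to \<open>m = r = 0\<close>, is counted separately because it has no
  blocks at all; with it the recurrences need no special case.
\<close>

definition block_gf :: "real \<Rightarrow> nat \<Rightarrow> nat \<Rightarrow> nat \<Rightarrow> real" where
  "block_gf q k m r = (if m = 0 \<and> r = 0 then 1 else 0) +
     (\<Sum>s=1..r. E_bar q k m r s + F_bar q k m r s)"

text \<open>
  There are at most as many blocks of failures as failures, so the number of blocks may range up to
  any common bound. The term \<open>s = 0\<close> of \<open>F_bar\<close> is the contribution of the empty sequence.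
\<close>

lemma block_gf_extend:
  assumes "r \<le> N"
  shows "block_gf q k m r = (\<Sum>s=1..N. E_bar q k m r s) + (\<Sum>s=0..N. F_bar q k m r s)"
proof -
  have "(\<Sum>s=1..N. E_bar q k m r s) = (\<Sum>s=1..r. E_bar q k m r s)"
    using assms by (intro sum.mono_neutral_right) (auto simp: E_bar_empty)
  moreover have "(\<Sum>s=1..N. F_bar q k m r s) = (\<Sum>s=1..r. F_bar q k m r s)"
    using assms by (intro sum.mono_neutral_right) (auto simp: F_bar_empty)
  ultimately show ?thesis
    by (simp add: block_gf_def sum.distrib F_bar_0 sum.atLeast_Suc_atMost[of 0])
qed

text \<open>
  Sequences are sorted by their last block \<open>u\<close> of successes and by the number \<open>t\<close> of failures
  before this block. The leading term is the sequence without successes.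
\<close>

lemma block_gf_blocks:
  "block_gf q k m r = (if m = 0 then 1 else 0) +
     (\<Sum>t<r. \<Sum>u | u \<in> {1..m} \<and> u < k. q ^ (t * u) * block_gf q k (m - u) t)"
proof (cases r)
  case 0
  thus ?thesis by (simp add: block_gf_def)
next
  case (Suc N)
  let ?U = "{u. u \<in> {1..m} \<and> u < k}"
  have "block_gf q k m r = (\<Sum>s=1..Suc N. E_bar q k m r s) + (\<Sum>s=0..Suc N. F_bar q k m r s)"
    using Suc by (intro block_gf_extend) simp
  also have "(\<Sum>s=1..Suc N. E_bar q k m r s) =
      (if m = 0 then 1 else 0) + (\<Sum>s=1..N. E_bar q k m r (Suc s))"
    using Suc E_bar_1[of q k m r]
    by (simp add: sum.atLeast_Suc_atMost[of "Suc 0" "Suc N"]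
        sum.shift_bounds_cl_Suc_ivl[of _ "Suc 0"] del: sum.cl_ivl_Suc)
  also have "(\<Sum>s=1..N. E_bar q k m r (Suc s)) = (\<Sum>s=1..N. \<Sum>u\<in>?U. \<Sum>v=1..r.
      q ^ ((r - v) * u) * E_bar q k (m - u) (r - v) s)"
  proof (intro sum.cong refl)
    fix s assume "s \<in> {1..N}"
    then obtain s' where "s = Suc s'" by (cases s) auto
    thus "E_bar q k m r (Suc s) = (\<Sum>u\<in>?U. \<Sum>v=1..r.
      q ^ ((r - v) * u) * E_bar q k (m - u) (r - v) s)" using E_bar_Suc by simp
  qed
  also have "\<dots> = (\<Sum>u\<in>?U. \<Sum>s=1..N. \<Sum>v=1..r.
      q ^ ((r - v) * u) * E_bar q k (m - u) (r - v) s)" by (rule sum.swap)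
  also have "\<dots> = (\<Sum>u\<in>?U. \<Sum>v=1..r. \<Sum>s=1..N.
      q ^ ((r - v) * u) * E_bar q k (m - u) (r - v) s)" by (intro sum.cong refl sum.swap)
  also have "(\<Sum>s=0..Suc N. F_bar q k m r s) = (\<Sum>s=0..N. F_bar q k m r (Suc s))"
    using Suc F_bar_0[of q k m r]
    by (simp add: sum.atLeast_Suc_atMost[of 0] sum.atLeast_Suc_atMost_Suc_shift del: sum.cl_ivl_Suc)
  also have "\<dots> = (\<Sum>s=0..N. \<Sum>u\<in>?U. \<Sum>v=1..r.
      q ^ ((r - v) * u) * F_bar q k (m - u) (r - v) s)" by (simp only: F_bar_Suc)
  also have "\<dots> = (\<Sum>u\<in>?U. \<Sum>s=0..N. \<Sum>v=1..r.
      q ^ ((r - v) * u) * F_bar q k (m - u) (r - v) s)" by (rule sum.swap)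
  also have "\<dots> = (\<Sum>u\<in>?U. \<Sum>v=1..r. \<Sum>s=0..N.
      q ^ ((r - v) * u) * F_bar q k (m - u) (r - v) s)" by (intro sum.cong refl sum.swap)
  finally have "block_gf q k m r = (if m = 0 then 1 else 0) + (\<Sum>u\<in>?U. \<Sum>v=1..r.
      q ^ ((r - v) * u) * ((\<Sum>s=1..N. E_bar q k (m - u) (r - v) s) +
        (\<Sum>s=0..N. F_bar q k (m - u) (r - v) s)))"
    by (simp add: sum.distrib distrib_left sum_distrib_left)
  also have "\<dots> = (if m = 0 then 1 else 0) + (\<Sum>u\<in>?U. \<Sum>v=1..r.
      q ^ ((r - v) * u) * block_gf q k (m - u) (r - v))"
    using Suc by (intro arg_cong2[of _ _ _ _ "(+)"] sum.cong refl arg_cong2[of _ _ _ _ "(*)"])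
      (subst block_gf_extend[of _ N], auto)
  also have "(\<Sum>u\<in>?U. \<Sum>v=1..r. q ^ ((r - v) * u) * block_gf q k (m - u) (r - v)) =
      (\<Sum>u\<in>?U. \<Sum>t<r. q ^ (t * u) * block_gf q k (m - u) t)"
    by (rule sum.cong[OF refl], rule sum.reindex_bij_witness[of _ "\<lambda>t. r - t" "\<lambda>v. r - v"]) auto
  also have "\<dots> = (\<Sum>t<r. \<Sum>u\<in>?U. q ^ (t * u) * block_gf q k (m - u) t)" by (rule sum.swap)
  finally show ?thesis .
qed

lemma block_gf_0: "block_gf q k m 0 = (if m = 0 then 1 else 0)"
  by (simp add: block_gf_def)

text \<open>
  The recurrences \<open>block_gf_blocks\<close> at \<open>r\<close> and at \<open>Suc r\<close> differ by the summand \<open>t = r\<close>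
  only, and the value at \<open>r\<close> itself is the summand \<open>z = 0\<close>.
\<close>

lemma block_gf_Suc:
  assumes "k \<ge> 1"
  shows "block_gf q k m (Suc r) =
    (\<Sum>z | z \<le> m \<and> z < k. q ^ (r * z) * block_gf q k (m - z) r)"
proof -
  have "{z. z \<le> m \<and> z < k} = insert 0 {u. u \<in> {1..m} \<and> u < k}" using assms by auto
  moreover have "finite {u. u \<in> {1..m} \<and> u < k}" by simp
  ultimately have "(\<Sum>z | z \<le> m \<and> z < k. q ^ (r * z) * block_gf q k (m - z) r) =
    block_gf q k m r + (\<Sum>u | u \<in> {1..m} \<and> u < k. q ^ (r * u) * block_gf q k (m - u) r)"
    by (simp only: sum.insert) simp
  thus ?thesis
    using block_gf_blocks[of q k m "Suc r"] block_gf_blocks[of q k m r] by simp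
qed

text \<open>
  For \<open>k = 1\<close> the maximum condition with bound \<open>k - 1 = 0\<close> is vacuous, while no nonempty tuple
  has all its parts below \<open>1\<close>. The two readings differ on the empty tuple, which \<open>m \<ge> 1\<close>
  excludes.
\<close>

lemma S_set_diff_bounded_comps:
  assumes "k \<ge> 1" "m \<ge> 1"
  shows "S_set (k - 1) m s = S_set 0 m s - bounded_comps k m s"
proof -
  have "\<exists>j\<in>{1..s}. 1 \<le> x j" if "x \<in> S_set 0 m s" for x
  proof -
    have "s \<noteq> 0" using that assms(2) by (cases s) (auto simp: S_set_def)
    thus ?thesis using that by (force simp: S_set_def PiE_iff intro!: bexI[of _ 1])
  qed
  moreover have "S_set (k - 1) m s \<subseteq> S_set 0 m s" by (auto simp: S_set_def)
  moreover have "x \<in> S_set (k - 1) m s \<longleftrightarrow> x \<in> S_set 0 m s \<and> (k = 1 \<or> (\<exists>j\<in>{1..s}. k \<le> x j))" for x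
    using assms(1) by (force simp: S_set_def)
  ultimately show ?thesis by (fastforce simp: bounded_comps_def not_less)
qed

text \<open>
  The tuples \<open>x\<close> with a part of at least \<open>k\<close> are all tuples but those with every part below \<open>k\<close>;
  the weights of \<open>K_sum\<close> and \<open>E_bar\<close> agree, as do those of \<open>L_sum\<close> and \<open>F_bar\<close>.
\<close>

lemma K_sum_diff:
  assumes "k \<ge> 1" "m \<ge> 1" "m < k'"
  shows "K_sum q k m r s = E_bar q k' m r s - E_bar q k m r s"
  unfolding K_sum_def E_bar_alt S_set_diff_bounded_comps[OF assms(1,2)]
    bounded_comps_large_bound[OF assms(3)]
  by (rule sum_diff) (auto simp: finite_S_set bounded_comps_def)

lemma L_sum_diff:
  assumes "k \<ge> 1" "m \<ge> 1" "m < k'"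
  shows "L_sum q k m r s = F_bar q k' m r s - F_bar q k m r s"
  unfolding L_sum_def F_bar_alt S_set_diff_bounded_comps[OF assms(1,2)]
    bounded_comps_large_bound[OF assms(3)]
  by (rule sum_diff) (auto simp: finite_S_set bounded_comps_def)

section \<open>Outcome sequences ending in a failure\<close>

definition zeros :: "(nat \<Rightarrow> nat) \<Rightarrow> nat \<Rightarrow> nat" where
  "zeros a N = card {j \<in> {1..N}. a j = 0}"

definition run_free :: "nat \<Rightarrow> nat \<Rightarrow> (nat \<Rightarrow> nat) \<Rightarrow> bool" where
  "run_free k N a \<longleftrightarrow> (\<forall>j\<in>{k..N}. \<exists>i\<in>{j - k + 1..j}. a i \<noteq> 1)"

text \<open>
  The \<open>r\<close>-th failure occurs at trial \<open>m + r\<close> and no run of \<open>k\<close> successes precedes it. The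
  start of the sequence, \<open>m = r = 0\<close>, counts as such a point, so that every later one arises from
  an earlier one.
\<close>

definition failure_end :: "nat \<Rightarrow> nat \<Rightarrow> nat \<Rightarrow> (nat \<Rightarrow> nat) \<Rightarrow> bool" where
  "failure_end k m r a \<longleftrightarrow>
     zeros a (m + r) = r \<and> (m + r = 0 \<or> a (m + r) = 0) \<and> run_free k (m + r) a"

lemma zeros_0 [simp]: "zeros a 0 = 0"
  by (simp add: zeros_def)

lemma zeros_Suc: "zeros a (Suc N) = zeros a N + (if a (Suc N) = 0 then 1 else 0)"
proof -
  have "{j \<in> {1..Suc N}. a j = 0} =
      (if a (Suc N) = 0 then insert (Suc N) {j \<in> {1..N}. a j = 0} else {j \<in> {1..N}. a j = 0})"
    by (auto simp: le_Suc_eq)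
  thus ?thesis by (simp add: zeros_def)
qed

lemma zeros_le: "zeros a N \<le> N"
  by (induction N) (auto simp: zeros_Suc)

lemma zeros_mono: "L \<le> N \<Longrightarrow> zeros a L \<le> zeros a N"
  by (induction N) (auto simp: zeros_Suc le_Suc_eq)

lemma zeros_pos: "1 \<le> N \<Longrightarrow> a N = 0 \<Longrightarrow> zeros a N > zeros a (N - 1)"
  by (cases N) (auto simp: zeros_Suc)

lemma zeros_ones:
  assumes "L \<le> N" "\<forall>j\<in>{L + 1..N}. a j = 1"
  shows "zeros a N = zeros a L"
  using assms
proof (induction N rule: dec_induct)
  case (step N)
  hence "a (Suc N) = 1" by simp
  thus ?case using step by (simp add: zeros_Suc)
qed simp

lemma run_free_mono: "run_free k N a \<Longrightarrow> L \<le> N \<Longrightarrow> run_free k L a"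
  by (auto simp: run_free_def)

text \<open>
  After a failure at trial \<open>L\<close>, or from the start, a new run of length \<open>k\<close> takes \<open>k\<close> trials.
\<close>

lemma run_free_extend:
  assumes "run_free k L a" "L = 0 \<or> a L = 0" "N < L + k"
  shows "run_free k N a"
  unfolding run_free_def
proof
  fix j assume j: "j \<in> {k..N}"
  show "\<exists>i\<in>{j - k + 1..j}. a i \<noteq> 1"
  proof (cases "j \<le> L")
    case True
    thus ?thesis using assms(1) j by (auto simp: run_free_def)
  next
    case False
    hence "L \<in> {j - k + 1..j}" "a L \<noteq> 1" using assms(2,3) j by auto
    thus ?thesis by blast
  qed
qed

lemma run_free_Suc_failure:
  assumes "k \<ge> 1" "a (Suc N) = 0"
  shows "run_free k (Suc N) a \<longleftrightarrow> run_free k N a"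
proof
  assume free: "run_free k N a"
  show "run_free k (Suc N) a" unfolding run_free_def
  proof
    fix j assume j: "j \<in> {k..Suc N}"
    show "\<exists>i\<in>{j - k + 1..j}. a i \<noteq> 1"
    proof (cases "j = Suc N")
      case True
      thus ?thesis using assms j by (intro bexI[of _ "Suc N"]) auto
    next
      case False
      thus ?thesis using free j by (auto simp: run_free_def)
    qed
  qed
qed (auto intro: run_free_mono)

lemma failure_end_0: "k \<ge> 1 \<Longrightarrow> failure_end k m 0 a \<longleftrightarrow> m = 0"
  using zeros_pos[of m a] by (cases "m = 0") (auto simp: failure_end_def run_free_def)

text \<open>
  The last failure is preceded by a block of \<open>z\<close> successes, possibly empty, and this block by the
  previous failure or the start of the sequence. The bound \<open>z < k\<close> is all that run-freeness
  demands of the block.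
\<close>

lemma failure_end_Suc:
  assumes "k \<ge> 1" and bin: "\<And>j. 1 \<le> j \<Longrightarrow> a j \<in> {0, 1}"
  shows "failure_end k m (Suc r) a \<longleftrightarrow>
    (\<exists>z. z \<le> m \<and> z < k \<and> failure_end k (m - z) r a \<and>
      (\<forall>j\<in>{m - z + r + 1..m + r}. a j = 1) \<and> a (Suc (m + r)) = 0)"
    (is "?L \<longleftrightarrow> ?R")
proof
  assume ?L
  hence z: "zeros a (m + r) = r" and 0: "a (Suc (m + r)) = 0"
    and free: "run_free k (m + r) a"
    using run_free_Suc_failure[OF assms(1)] by (auto simp: failure_end_def zeros_Suc)
  \<comment> \<open>the position of the previous failure, with \<open>0\<close> standing for the start\<close>
  define L where "L = Max (insert 0 {j \<in> {1..m + r}. a j = 0})"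
  have L_in: "L \<in> insert 0 {j \<in> {1..m + r}. a j = 0}"
    unfolding L_def by (intro Max_in) auto
  have L_max: "j \<le> L" if "1 \<le> j" "j \<le> m + r" "a j = 0" for j
    unfolding L_def using that by (intro Max_ge) auto
  have ones: "\<forall>j\<in>{L + 1..m + r}. a j = 1"
  proof
    fix j assume j: "j \<in> {L + 1..m + r}"
    hence "a j \<noteq> 0" using L_max[of j] by auto
    thus "a j = 1" using bin[of j] j by auto
  qed
  have "L \<le> m + r" using L_in by auto
  have "zeros a L = r" using zeros_ones[OF \<open>L \<le> m + r\<close> ones] z by simp
  hence "r \<le> L" using zeros_le[of a L] by simp
  define z where "z = m + r - L"
  have zm: "z \<le> m" and L: "m - z + r = L" using \<open>r \<le> L\<close> \<open>L \<le> m + r\<close> by (auto simp: z_def)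
  have "z < k"
  proof (rule ccontr)
    assume "\<not> z < k"
    hence "\<exists>i\<in>{m + r - k + 1..m + r}. a i \<noteq> 1"
      using free zm unfolding run_free_def by auto
    thus False using ones \<open>\<not> z < k\<close> zm L by fastforce
  qed
  moreover have "failure_end k (m - z) r a"
    unfolding failure_end_def L
    using \<open>zeros a L = r\<close> L_in run_free_mono[OF free \<open>L \<le> m + r\<close>] by auto
  ultimately show ?R using zm ones 0 L by (intro exI[of _ z]) auto
next
  assume ?R
  then obtain z where z: "z \<le> m" "z < k" "failure_end k (m - z) r a"
    "\<forall>j\<in>{m - z + r + 1..m + r}. a j = 1" "a (Suc (m + r)) = 0" by blast
  have "zeros a (m + r) = r"
    using zeros_ones[OF _ z(4)] z(3) by (simp add: failure_end_def)
  moreover have "run_free k (m + r) a"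
    by (rule run_free_extend[of k "m - z + r"]) (use z in \<open>auto simp: failure_end_def\<close>)
  ultimately show ?L
    using z(5) assms(1) by (simp add: failure_end_def zeros_Suc run_free_Suc_failure)
qed

text \<open>
  Of two different candidates for the previous failure, the later one would lie within the block of
  successes that belongs to the earlier one.
\<close>

lemma failure_end_Suc_unique:
  assumes "failure_end k (m - z) r a" "\<forall>j\<in>{m - z + r + 1..m + r}. a j = 1" "z \<le> m"
    and "failure_end k (m - z') r a" "\<forall>j\<in>{m - z' + r + 1..m + r}. a j = 1" "z' \<le> m"
  shows "z = z'"
proof -
  have *: "\<not> u < v" if "failure_end k (m - u) r a"
    "\<forall>j\<in>{m - v + r + 1..m + r}. a j = 1" "v \<le> m" for u v
  proof
    assume "u < v"
    hence "m - u + r \<in> {m - v + r + 1..m + r}" using that(3) by auto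
    hence "a (m - u + r) = 1" using that(2) by blast
    thus False using that \<open>u < v\<close> by (auto simp: failure_end_def)
  qed
  show ?thesis using *[of z z'] *[of z' z] assms by linarith
qed

text \<open>
  A run of \<open>n + 1\<close> successes does not fit into \<open>n\<close> trials, so the first condition on the right
  says only that trial \<open>n\<close> is the \<open>r\<close>-th failure.
\<close>

lemma failure_end_unrestricted_diff:
  assumes "k \<ge> 1" "n \<ge> 1" "r \<le> n"
  shows "a n = 0 \<and> zeros a n = r \<and> \<not> run_free k (n - 1) a \<longleftrightarrow>
    failure_end (Suc n) (n - r) r a \<and> \<not> failure_end k (n - r) r a"
proof -
  have "run_free (Suc n) n a" by (simp add: run_free_def)
  moreover have "a n = 0 \<Longrightarrow> run_free k n a \<longleftrightarrow> run_free k (n - 1) a"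
    using run_free_Suc_failure[of k a "n - 1"] assms by simp
  ultimately show ?thesis using assms by (auto simp: failure_end_def)
qed

text \<open>
  If the last \<open>k\<close> trials up to \<open>n\<close> form the first run of length \<open>k\<close>, trial \<open>n - k\<close> must be a
  failure: a success there would have completed a run at trial \<open>n - 1\<close>. The assumptions
  \<open>l \<ge> 1\<close> and \<open>k + l \<le> n\<close> guarantee that trial \<open>n - k\<close> exists.
\<close>

lemma first_run_failure_end:
  assumes bin: "\<And>j. 1 \<le> j \<Longrightarrow> a j \<in> {0, 1}" and "k \<ge> 1" "l \<ge> 1" "k + l \<le> n"
  shows "(\<forall>j\<in>{n - k + 1..n}. a j = 1) \<and> run_free k (n - 1) a \<and> l \<le> zeros a (n - 1) \<longleftrightarrow>
    (\<exists>i\<in>{l..n - k}. failure_end k (n - k - i) i a \<and> (\<forall>j\<in>{n - k + 1..n}. a j = 1))"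
    (is "?L \<longleftrightarrow> ?R")
proof
  assume L: ?L
  have z: "zeros a (n - 1) = zeros a (n - k)"
    using L assms by (intro zeros_ones) auto
  have "a (n - k) = 0"
  proof (rule ccontr)
    assume "a (n - k) \<noteq> 0"
    hence "a (n - k) = 1" using bin[of "n - k"] assms by auto
    moreover have "\<exists>i\<in>{n - 1 - k + 1..n - 1}. a i \<noteq> 1"
      using L assms(2-4) unfolding run_free_def
      by (elim conjE) (drule bspec[of _ _ "n - 1"], auto)
    then obtain i where i: "i \<in> {n - 1 - k + 1..n - 1}" "a i \<noteq> 1" by blast
    hence "i = n - k \<or> i \<in> {n - k + 1..n}" using assms by auto
    ultimately show False using L i by auto
  qed
  moreover have "run_free k (n - k) a" using L assms by (auto intro: run_free_mono)
  moreover define i where "i = zeros a (n - k)"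
  moreover have i: "i \<in> {l..n - k}" using L z zeros_le[of a "n - k"] by (simp add: i_def)
  moreover have "n - k - i + i = n - k" using i by (simp only: atLeastAtMost_iff le_add_diff_inverse2)
  ultimately have "failure_end k (n - k - i) i a" by (simp add: failure_end_def)
  thus ?R using i L by blast
next
  assume ?R
  then obtain i where i: "i \<in> {l..n - k}" "failure_end k (n - k - i) i a"
    and ones: "\<forall>j\<in>{n - k + 1..n}. a j = 1" by blast
  have "n - k - i + i = n - k" using i(1) by (simp only: atLeastAtMost_iff le_add_diff_inverse2)
  moreover have "n - k \<noteq> 0" using assms(3,4) by simp
  ultimately have f: "zeros a (n - k) = i" "a (n - k) = 0" "run_free k (n - k) a"
    using i(2) unfolding failure_end_def by metis+
  have "run_free k (n - 1) a"
    by (rule run_free_extend[of k "n - k"]) (use f assms(2-4) in auto)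
  moreover have "zeros a (n - k) \<le> zeros a (n - 1)"
    using assms(2) by (intro zeros_mono) simp
  hence "l \<le> zeros a (n - 1)" using f(1) i(1) by simp
  ultimately show ?L using ones by blast
qed

section \<open>The waiting times\<close>

lemma Inf_enat_image_eq_iff:
  "Inf (enat ` A) = enat n \<longleftrightarrow> n \<in> A \<and> (\<forall>m\<in>A. n \<le> m)"
proof
  assume eq: "Inf (enat ` A) = enat n"
  hence "A \<noteq> {}" by (auto simp: Inf_enat_def)
  hence "Inf (enat ` A) \<in> enat ` A"
    unfolding Inf_enat_def using LeastI_ex[of "\<lambda>x. x \<in> enat ` A"] by auto
  hence "n \<in> A" using eq by auto
  moreover have "enat n \<le> enat m" if "m \<in> A" for m
    unfolding eq[symmetric] using that by (intro Inf_lower) auto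
  ultimately show "n \<in> A \<and> (\<forall>m\<in>A. n \<le> m)" by auto
next
  assume "n \<in> A \<and> (\<forall>m\<in>A. n \<le> m)"
  thus "Inf (enat ` A) = enat n" by (intro antisym Inf_lower Inf_greatest) auto
qed

lemma Inf_enat_image_less_iff: "Inf (enat ` A) < enat n \<longleftrightarrow> (\<exists>m\<in>A. m < n)"
  by (simp add: Inf_less_iff)

lemma success_run_time_less_iff:
  assumes "k \<ge> 1"
  shows "success_run_time X k \<omega> < enat n \<longleftrightarrow> \<not> run_free k (n - 1) (\<lambda>j. X j \<omega>)"
proof -
  have range: "m < n \<longleftrightarrow> m \<le> n - 1" if "k \<le> m" for m using that assms by auto
  have "success_run_time X k \<omega> < enat n \<longleftrightarrow>
      (\<exists>m. k \<le> m \<and> (\<forall>j\<in>{m - k + 1..m}. X j \<omega> = 1) \<and> m < n)"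
    unfolding success_run_time_def Inf_enat_image_less_iff by blast
  also have "\<dots> \<longleftrightarrow> (\<exists>m\<in>{k..n - 1}. \<forall>j\<in>{m - k + 1..m}. X j \<omega> = 1)"
    unfolding Bex_def[of "{k..n - 1}"] atLeastAtMost_iff using range by blast
  finally show ?thesis unfolding run_free_def by blast
qed

lemma success_run_time_eq_iff:
  assumes "1 \<le> k" "k \<le> n"
  shows "success_run_time X k \<omega> = enat n \<longleftrightarrow>
    (\<forall>j\<in>{n - k + 1..n}. X j \<omega> = 1) \<and> run_free k (n - 1) (\<lambda>j. X j \<omega>)"
proof -
  have Inf_eq: "Inf (enat ` A) = enat n \<longleftrightarrow> n \<in> A \<and> \<not> Inf (enat ` A) < enat n" for A
    unfolding Inf_enat_image_eq_iff Inf_enat_image_less_iff by (meson not_less)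
  have "success_run_time X k \<omega> = enat n \<longleftrightarrow>
      n \<in> {m. m \<ge> k \<and> (\<forall>j\<in>{m - k + 1..m}. X j \<omega> = 1)} \<and> \<not> success_run_time X k \<omega> < enat n"
    unfolding success_run_time_def by (rule Inf_eq)
  hence "success_run_time X k \<omega> = enat n \<longleftrightarrow>
      (\<forall>j\<in>{n - k + 1..n}. X j \<omega> = 1) \<and> \<not> success_run_time X k \<omega> < enat n"
    using assms(2) by simp
  thus ?thesis by (simp only: success_run_time_less_iff[OF assms(1)] not_not)
qed

text \<open>
  The number of failures grows in unit steps, so it takes the value \<open>k\<close>, at a failure, before it
  can exceed \<open>k\<close>.
\<close>

lemma failure_time_less_iff:
  assumes "k \<ge> 1"
  shows "failure_time X k \<omega> < enat n \<longleftrightarrow> k \<le> zeros (\<lambda>j. X j \<omega>) (n - 1)"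
proof -
  let ?a = "\<lambda>j. X j \<omega>"
  have "(\<exists>i. 1 \<le> i \<and> i \<le> N \<and> ?a i = 0 \<and> zeros ?a i = k) \<longleftrightarrow> k \<le> zeros ?a N" for N
  proof
    assume "k \<le> zeros ?a N"
    thus "\<exists>i. 1 \<le> i \<and> i \<le> N \<and> ?a i = 0 \<and> zeros ?a i = k"
    proof (induction N)
      case 0
      thus ?case using assms by simp
    next
      case (Suc N)
      show ?case
      proof (cases "k \<le> zeros ?a N")
        case True
        thus ?thesis using Suc.IH by (meson le_SucI)
      next
        case False
        thus ?thesis using Suc.prems
          by (intro exI[of _ "Suc N"]) (auto simp: zeros_Suc split: if_splits)
      qed
    qed
  next
    assume "\<exists>i. 1 \<le> i \<and> i \<le> N \<and> ?a i = 0 \<and> zeros ?a i = k"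
    then obtain i where "i \<le> N" "zeros ?a i = k" by blast
    thus "k \<le> zeros ?a N" using zeros_mono[of i N ?a] by simp
  qed
  moreover have "failure_time X k \<omega> < enat n \<longleftrightarrow>
      (\<exists>i. 1 \<le> i \<and> i \<le> n - 1 \<and> ?a i = 0 \<and> zeros ?a i = k)"
  proof -
    have "1 \<le> i \<and> i < n \<longleftrightarrow> 1 \<le> i \<and> i \<le> n - 1" for i by auto
    thus ?thesis
      unfolding failure_time_def Inf_enat_image_less_iff zeros_def[symmetric] by blast
  qed
  ultimately show ?thesis by blast
qed

lemma failure_time_eq_iff:
  "failure_time X k \<omega> = enat n \<longleftrightarrow> 1 \<le> n \<and> X n \<omega> = 0 \<and> zeros (\<lambda>j. X j \<omega>) n = k"
proof -
  let ?a = "\<lambda>j. X j \<omega>"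
  have "n \<le> m" if "1 \<le> n" "X n \<omega> = 0" "zeros ?a n = zeros ?a m" for m
  proof (rule ccontr)
    assume "\<not> n \<le> m"
    hence "zeros ?a m \<le> zeros ?a (n - 1)" by (intro zeros_mono) simp
    thus False using zeros_pos[of n ?a] that by simp
  qed
  thus ?thesis
    unfolding failure_time_def Inf_enat_image_eq_iff zeros_def[symmetric] by auto
qed

section \<open>Probabilities of events determined by finitely many trials\<close>

definition determined_by :: "nat \<Rightarrow> ((nat \<Rightarrow> nat) \<Rightarrow> bool) \<Rightarrow> bool" where
  "determined_by N R \<longleftrightarrow> (\<forall>a b. (\<forall>j\<in>{1..N}. a j = b j) \<longrightarrow> R a = R b)"

lemma determined_byD: "determined_by N R \<Longrightarrow> (\<And>j. j \<in> {1..N} \<Longrightarrow> a j = b j) \<Longrightarrow> R a = R b"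
  by (auto simp: determined_by_def)

lemma zeros_cong: "(\<And>j. j \<in> {1..N} \<Longrightarrow> a j = b j) \<Longrightarrow> zeros a N = zeros b N"
  unfolding zeros_def by (intro arg_cong[of _ _ card]) auto

lemma determined_by_failure_end:
  assumes "k \<ge> 1"
  shows "determined_by (m + r) (failure_end k m r)"
  unfolding determined_by_def
proof (intro allI impI)
  fix a b :: "nat \<Rightarrow> nat" assume eq: "\<forall>j\<in>{1..m + r}. a j = b j"
  have "run_free k (m + r) a \<longleftrightarrow> run_free k (m + r) b"
    unfolding run_free_def using eq by (intro ball_cong bex_cong) auto
  moreover have "zeros a (m + r) = zeros b (m + r)" using eq by (intro zeros_cong) auto
  moreover have "m + r = 0 \<or> a (m + r) = b (m + r)" using eq by auto
  ultimately show "failure_end k m r a = failure_end k m r b"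
    unfolding failure_end_def by auto
qed

lemma determined_by_ones:
  assumes "determined_by N R"
  shows "determined_by (N + z) (\<lambda>a. R a \<and> (\<forall>j\<in>{N + 1..N + z}. a j = 1))"
  unfolding determined_by_def
proof (intro allI impI)
  fix a b :: "nat \<Rightarrow> nat" assume eq: "\<forall>j\<in>{1..N + z}. a j = b j"
  have "R a = R b" using eq by (intro determined_byD[OF assms]) auto
  moreover have "(\<forall>j\<in>{N + 1..N + z}. a j = 1) \<longleftrightarrow> (\<forall>j\<in>{N + 1..N + z}. b j = 1)"
    using eq by (intro ball_cong) auto
  ultimately show "(R a \<and> (\<forall>j\<in>{N + 1..N + z}. a j = 1)) = (R b \<and> (\<forall>j\<in>{N + 1..N + z}. b j = 1))"
    by blast
qed

context q_bernoulli_seq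
begin

lemma value_event: "j \<ge> 1 \<Longrightarrow> {\<omega> \<in> space M. X j \<omega> = v} \<in> events"
  using measurable_sets[OF random_variable_X, of j "{v}"]
  by (simp add: vimage_def Int_def conj_commute)

lemma cylinder_event: "{\<omega> \<in> space M. \<forall>l\<in>{1..N}. X l \<omega> = w l} \<in> events"
  by (cases "N = 0") (auto intro!: sets.sets_Collect_finite_All' value_event)

text \<open>
  An event that depends on the first \<open>N\<close> trials is a finite union of cylinders, over the binary words
  that satisfy it. The extra condition \<open>A\<close> makes room for the outcome of the next trial.
\<close>

lemma determined_event_eq:
  assumes "determined_by N R"
  shows "{\<omega> \<in> space M. R (\<lambda>j. X j \<omega>) \<and> A \<omega>} =
    (\<Union>w\<in>{w \<in> {1..N} \<rightarrow>\<^sub>E {0, 1}. R w}. {\<omega> \<in> space M. A \<omega> \<and> (\<forall>l\<in>{1..N}. X l \<omega> = w l)})"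
proof (intro equalityI subsetI)
  fix \<omega> assume \<omega>: "\<omega> \<in> {\<omega> \<in> space M. R (\<lambda>j. X j \<omega>) \<and> A \<omega>}"
  let ?w = "restrict (\<lambda>j. X j \<omega>) {1..N}"
  have "?w \<in> {1..N} \<rightarrow>\<^sub>E {0, 1}"
    using X_binary \<omega> by (intro restrict_PiE_iff[THEN iffD2]) auto
  moreover have "R ?w = R (\<lambda>j. X j \<omega>)" by (intro determined_byD[OF assms]) auto
  ultimately show "\<omega> \<in> (\<Union>w\<in>{w \<in> {1..N} \<rightarrow>\<^sub>E {0, 1}. R w}.
      {\<omega> \<in> space M. A \<omega> \<and> (\<forall>l\<in>{1..N}. X l \<omega> = w l)})"
    using \<omega> by (intro UN_I[of ?w]) auto
next
  fix \<omega> assume "\<omega> \<in> (\<Union>w\<in>{w \<in> {1..N} \<rightarrow>\<^sub>E {0, 1}. R w}.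
      {\<omega> \<in> space M. A \<omega> \<and> (\<forall>l\<in>{1..N}. X l \<omega> = w l)})"
  then obtain w where w: "R w" "\<omega> \<in> space M" "A \<omega>" "\<forall>l\<in>{1..N}. X l \<omega> = w l" by blast
  have "R (\<lambda>j. X j \<omega>) = R w" using w by (intro determined_byD[OF assms]) auto
  thus "\<omega> \<in> {\<omega> \<in> space M. R (\<lambda>j. X j \<omega>) \<and> A \<omega>}" using w by simp
qed

lemma finite_words: "finite {w \<in> {1..N :: nat} \<rightarrow>\<^sub>E {0, 1 :: nat}. R w}"
  by (rule finite_subset[OF _ finite_PiE[of "{1..N}" "\<lambda>_. {0, 1}"]]) auto

lemma determined_event:
  assumes "determined_by N R"
  shows "{\<omega> \<in> space M. R (\<lambda>j. X j \<omega>)} \<in> events"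
proof -
  have "{\<omega> \<in> space M. R (\<lambda>j. X j \<omega>)} =
      (\<Union>w\<in>{w \<in> {1..N} \<rightarrow>\<^sub>E {0, 1}. R w}. {\<omega> \<in> space M. \<forall>l\<in>{1..N}. X l \<omega> = w l})"
    using determined_event_eq[OF assms, of "\<lambda>_. True"] by simp
  thus ?thesis
    by (simp only:) (intro sets.finite_UN finite_words cylinder_event)
qed

lemma prob_determined:
  assumes "determined_by N R" "{\<omega> \<in> space M. A \<omega>} \<in> events"
  shows "\<P>(\<omega> in M. R (\<lambda>j. X j \<omega>) \<and> A \<omega>) =
    (\<Sum>w | w \<in> {1..N} \<rightarrow>\<^sub>E {0, 1} \<and> R w. \<P>(\<omega> in M. A \<omega> \<and> (\<forall>l\<in>{1..N}. X l \<omega> = w l)))"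
  unfolding determined_event_eq[OF assms(1)]
proof (rule finite_measure_finite_Union)
  show "(\<lambda>w. {\<omega> \<in> space M. A \<omega> \<and> (\<forall>l\<in>{1..N}. X l \<omega> = w l)}) `
      {w \<in> {1..N} \<rightarrow>\<^sub>E {0, 1}. R w} \<subseteq> events"
    using assms(2) cylinder_event by (auto intro!: sets.sets_Collect_conj)
  show "disjoint_family_on (\<lambda>w. {\<omega> \<in> space M. A \<omega> \<and> (\<forall>l\<in>{1..N}. X l \<omega> = w l)})
      {w \<in> {1..N} \<rightarrow>\<^sub>E {0, 1}. R w}"
    unfolding disjoint_family_on_def
  proof (intro ballI impI, rule ccontr)
    fix v w assume vw: "v \<in> {w \<in> {1..N} \<rightarrow>\<^sub>E {0, 1}. R w}" "w \<in> {w \<in> {1..N} \<rightarrow>\<^sub>E {0, 1}. R w}" "v \<noteq> w"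
      and "{\<omega> \<in> space M. A \<omega> \<and> (\<forall>l\<in>{1..N}. X l \<omega> = v l)} \<inter>
        {\<omega> \<in> space M. A \<omega> \<and> (\<forall>l\<in>{1..N}. X l \<omega> = w l)} \<noteq> {}"
    then obtain \<omega> where "\<forall>l\<in>{1..N}. X l \<omega> = v l" "\<forall>l\<in>{1..N}. X l \<omega> = w l" by blast
    hence "\<forall>l\<in>{1..N}. v l = w l" by metis
    hence "v = w" using vw by (auto intro: PiE_ext)
    thus False using vw by simp
  qed
qed (rule finite_words)

text \<open>
  The law is given for cylinders only. It extends to every event that fixes the number \<open>c\<close> of
  failures so far, since the conditional probability is then the same on all its cylinders. On
  cylinders of probability \<open>0\<close> there is no conditional probability, but both sides vanish.
\<close>

lemma prob_next_trial:
  assumes R: "determined_by N R" "\<And>a. R a \<Longrightarrow> zeros a N = c" and v: "v \<in> {0, 1}"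
  shows "\<P>(\<omega> in M. R (\<lambda>j. X j \<omega>) \<and> X (Suc N) \<omega> = v) =
    (if v = 0 then 1 - \<theta> * q ^ c else \<theta> * q ^ c) * \<P>(\<omega> in M. R (\<lambda>j. X j \<omega>))"
proof -
  let ?f = "if v = 0 then 1 - \<theta> * q ^ c else \<theta> * q ^ c"
  have cyl: "\<P>(\<omega> in M. X (Suc N) \<omega> = v \<and> (\<forall>l\<in>{1..N}. X l \<omega> = w l)) =
      ?f * \<P>(\<omega> in M. \<forall>l\<in>{1..N}. X l \<omega> = w l)" (is "?p = _ * ?c")
    if w: "w \<in> {1..N} \<rightarrow>\<^sub>E {0, 1}" "R w" for w
  proof (cases "?c = 0")
    case True
    have "?p \<le> ?c" by (intro finite_measure_mono cylinder_event) auto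
    thus ?thesis using True by (simp add: measure_le_0_iff)
  next
    case False
    hence pos: "\<P>(\<omega> in M. \<forall>l\<in>{1..<Suc N}. X l \<omega> = w l) > 0"
      by (simp add: atLeastLessThanSuc_atLeastAtMost zero_less_measure_iff)
    have w': "w \<in> {1..<Suc N} \<rightarrow> {0, 1}" using w(1) by (auto simp: PiE_iff)
    have "card {l \<in> {1..<Suc N}. w l = 0} = c"
      using R(2)[OF w(2)] by (simp add: zeros_def atLeastLessThanSuc_atLeastAtMost)
    hence "cond_prob M (\<lambda>\<omega>. X (Suc N) \<omega> = v) (\<lambda>\<omega>. \<forall>l\<in>{1..<Suc N}. X l \<omega> = w l) = ?f"
      using cond_failure[OF _ w' pos] cond_success[OF _ w' pos] v by auto
    thus ?thesis using False
      by (simp add: cond_prob_def atLeastLessThanSuc_atLeastAtMost divide_eq_eq)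
  qed
  have "\<P>(\<omega> in M. R (\<lambda>j. X j \<omega>) \<and> X (Suc N) \<omega> = v) =
      (\<Sum>w | w \<in> {1..N} \<rightarrow>\<^sub>E {0, 1} \<and> R w. ?f * \<P>(\<omega> in M. \<forall>l\<in>{1..N}. X l \<omega> = w l))"
    unfolding prob_determined[OF R(1) value_event[of "Suc N" v, simplified]]
    by (intro sum.cong refl cyl) auto
  also have "\<dots> = ?f * \<P>(\<omega> in M. R (\<lambda>j. X j \<omega>))"
    using prob_determined[OF R(1), of "\<lambda>_. True"] by (simp add: sum_distrib_left)
  finally show ?thesis .
qed

lemma prob_next_successes:
  assumes R: "determined_by N R" "\<And>a. R a \<Longrightarrow> zeros a N = c"
  shows "\<P>(\<omega> in M. R (\<lambda>j. X j \<omega>) \<and> (\<forall>j\<in>{N + 1..N + z}. X j \<omega> = 1)) =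
    (\<theta> * q ^ c) ^ z * \<P>(\<omega> in M. R (\<lambda>j. X j \<omega>))"
proof (induction z)
  case (Suc z)
  let ?R = "\<lambda>a. R a \<and> (\<forall>j\<in>{N + 1..N + z}. a j = 1)"
  have "zeros a (N + z) = c" if "?R a" for a
    using zeros_ones[of N "N + z" a] R(2) that by simp
  from prob_next_trial[OF determined_by_ones[OF R(1)] this, of 1]
  have "\<P>(\<omega> in M. ?R (\<lambda>j. X j \<omega>) \<and> X (Suc (N + z)) \<omega> = 1) =
      \<theta> * q ^ c * \<P>(\<omega> in M. ?R (\<lambda>j. X j \<omega>))" by simp
  moreover have "?R (\<lambda>j. X j \<omega>) \<and> X (Suc (N + z)) \<omega> = 1 \<longleftrightarrow>
      R (\<lambda>j. X j \<omega>) \<and> (\<forall>j\<in>{N + 1..N + Suc z}. X j \<omega> = 1)" for \<omega>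
    by (auto simp: le_Suc_eq)
  ultimately show ?case using Suc.IH by simp
qed simp

text \<open>
  Induction on the number of failures: by \<open>failure_end_Suc\<close> the probabilities satisfy the
  recurrence \<open>block_gf_Suc\<close>, with the conditional probabilities of the removed trials as factors.
\<close>

lemma prob_failure_end:
  assumes "k \<ge> 1"
  shows "\<P>(\<omega> in M. failure_end k m r (\<lambda>j. X j \<omega>)) =
    \<theta> ^ m * (\<Prod>j=1..r. 1 - \<theta> * q ^ (j - 1)) * block_gf q k m r"
proof (induction r arbitrary: m)
  case 0
  show ?case using assms by (cases "m = 0") (auto simp: failure_end_0 block_gf_0 prob_space)
next
  case (Suc r)
  let ?Z = "{z. z \<le> m \<and> z < k}"
  let ?R = "\<lambda>z a. failure_end k (m - z) r a \<and> (\<forall>j\<in>{m - z + r + 1..m - z + r + z}. a j = 1)"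
  let ?A = "\<lambda>z. {\<omega> \<in> space M. ?R z (\<lambda>j. X j \<omega>) \<and> X (Suc (m + r)) \<omega> = 0}"
  have det: "determined_by (m + r) (?R z)" if "z \<in> ?Z" for z
    using determined_by_ones[OF determined_by_failure_end[OF assms, of "m - z" r], of z] that
    by simp
  have "{\<omega> \<in> space M. failure_end k m (Suc r) (\<lambda>j. X j \<omega>)} = (\<Union>z\<in>?Z. ?A z)"
  proof -
    have "failure_end k m (Suc r) (\<lambda>j. X j \<omega>) \<longleftrightarrow>
        (\<exists>z\<in>?Z. ?R z (\<lambda>j. X j \<omega>) \<and> X (Suc (m + r)) \<omega> = 0)" if "\<omega> \<in> space M" for \<omega>
    proof -
      have "m - z + r + z = m + r" if "z \<le> m" for z using that by simp
      thus ?thesis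
        using failure_end_Suc[OF assms, of "\<lambda>j. X j \<omega>" m r] X_binary[OF _ that]
        by (simp only: mem_Collect_eq Bex_def conj_assoc cong: conj_cong)
    qed
    thus ?thesis by blast
  qed
  moreover have "prob (\<Union>z\<in>?Z. ?A z) = (\<Sum>z\<in>?Z. prob (?A z))"
  proof (rule finite_measure_finite_Union)
    show "?A ` ?Z \<subseteq> events"
    proof (rule image_subsetI)
      fix z assume "z \<in> ?Z"
      thus "?A z \<in> events"
        by (intro sets.sets_Collect_conj determined_event[OF det] value_event) auto
    qed
    show "disjoint_family_on ?A ?Z"
      unfolding disjoint_family_on_def
    proof (intro ballI impI equals0I)
      fix z z' \<omega> assume z: "z \<in> ?Z" "z' \<in> ?Z" "z \<noteq> z'" "\<omega> \<in> ?A z \<inter> ?A z'"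
      hence "m - z + r + z = m + r" "m - z' + r + z' = m + r" by auto
      hence "z = z'"
        using z failure_end_Suc_unique[of k m z r "\<lambda>j. X j \<omega>" z'] by simp
      thus False using z by simp
    qed
  qed simp
  moreover have "prob (?A z) = \<theta> ^ m * (\<Prod>j=1..Suc r. 1 - \<theta> * q ^ (j - 1)) *
      (q ^ (r * z) * block_gf q k (m - z) r)" if z: "z \<in> ?Z" for z
  proof -
    have fe: "zeros a (m - z + r) = r" if "failure_end k (m - z) r a" for a
      using that by (simp add: failure_end_def)
    have "zeros a (m + r) = r" if "?R z a" for a
      using zeros_ones[of "m - z + r" "m + r" a] fe[of a] that z by auto
    hence "prob (?A z) = (1 - \<theta> * q ^ r) * \<P>(\<omega> in M. ?R z (\<lambda>j. X j \<omega>))"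
      using prob_next_trial[OF det[OF z], of r 0] by simp
    also have "\<P>(\<omega> in M. ?R z (\<lambda>j. X j \<omega>)) =
        (\<theta> * q ^ r) ^ z * \<P>(\<omega> in M. failure_end k (m - z) r (\<lambda>j. X j \<omega>))"
      by (rule prob_next_successes[OF determined_by_failure_end[OF assms] fe])
    also have "\<dots> = (\<theta> * q ^ r) ^ z * (\<theta> ^ (m - z) * (\<Prod>j=1..r. 1 - \<theta> * q ^ (j - 1)) *
        block_gf q k (m - z) r)" by (simp only: Suc.IH)
    also have "(\<theta> * q ^ r) ^ z = \<theta> ^ z * q ^ (r * z)"
      by (simp add: power_mult_distrib power_mult)
    finally have "prob (?A z) = (\<theta> ^ z * \<theta> ^ (m - z)) * ((\<Prod>j=1..r. 1 - \<theta> * q ^ (j - 1)) *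
        (1 - \<theta> * q ^ r)) * (q ^ (r * z) * block_gf q k (m - z) r)"
      by (simp only: mult_ac)
    moreover have "\<theta> ^ z * \<theta> ^ (m - z) = \<theta> ^ m" using z by (simp flip: power_add)
    ultimately show ?thesis by simp
  qed
  ultimately show ?case
    by (simp add: block_gf_Suc[OF assms] sum_distrib_left)
qed

lemma P1_L_eq:
  assumes "k1 \<ge> 1" "k2 \<ge> 1" "k1 + k2 \<le> n"
  shows "P1_L M X k1 k2 n =
    (\<Sum>i=k2..n - k1. \<theta> ^ (n - i) * q ^ (i * k1) * (\<Prod>j=1..i. 1 - \<theta> * q ^ (j - 1)) *
      (\<Sum>s=1..i. E_bar q k1 (n - k1 - i) i s + F_bar q k1 (n - k1 - i) i s))"
proof -
  let ?R = "\<lambda>i a. failure_end k1 (n - k1 - i) i a \<and> (\<forall>j\<in>{n - k1 + 1..n}. a j = 1)"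
  let ?A = "\<lambda>i. {\<omega> \<in> space M. ?R i (\<lambda>j. X j \<omega>)}"
  have len: "n - k1 - i + i = n - k1" "n - k1 + k1 = n" if "i \<in> {k2..n - k1}" for i
    using that assms(3) by auto
  have "success_run_time X k1 \<omega> = enat n \<and> failure_time X k2 \<omega> < enat n \<longleftrightarrow>
      (\<exists>i\<in>{k2..n - k1}. ?R i (\<lambda>j. X j \<omega>))" if "\<omega> \<in> space M" for \<omega>
    using first_run_failure_end[of "\<lambda>j. X j \<omega>" k1 k2 n] X_binary[OF _ that] assms
    by (auto simp: success_run_time_eq_iff failure_time_less_iff)
  hence "{\<omega> \<in> space M. success_run_time X k1 \<omega> = enat n \<and> failure_time X k2 \<omega> < enat n} =
      (\<Union>i\<in>{k2..n - k1}. ?A i)" by blast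
  hence "P1_L M X k1 k2 n = prob (\<Union>i\<in>{k2..n - k1}. ?A i)"
    by (simp only: P1_L_def)
  also have "\<dots> = (\<Sum>i\<in>{k2..n - k1}. prob (?A i))"
  proof (rule finite_measure_finite_Union)
    have "determined_by n (?R i)" if "i \<in> {k2..n - k1}" for i
      using determined_by_ones[OF determined_by_failure_end[OF assms(1), of "n - k1 - i" i], of k1]
      unfolding len[OF that] .
    from determined_event[OF this] show "?A ` {k2..n - k1} \<subseteq> events" by auto
    show "disjoint_family_on ?A {k2..n - k1}"
      by (auto simp: disjoint_family_on_def failure_end_def)
  qed simp
  also have "\<dots> = (\<Sum>i=k2..n - k1. \<theta> ^ (n - i) * q ^ (i * k1) *
      (\<Prod>j=1..i. 1 - \<theta> * q ^ (j - 1)) *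
      (\<Sum>s=1..i. E_bar q k1 (n - k1 - i) i s + F_bar q k1 (n - k1 - i) i s))"
  proof (intro sum.cong refl)
    fix i assume i: "i \<in> {k2..n - k1}"
    have fe: "zeros a (n - k1 - i + i) = i" if "failure_end k1 (n - k1 - i) i a" for a
      using that by (simp add: failure_end_def)
    have "prob (?A i) = (\<theta> * q ^ i) ^ k1 * \<P>(\<omega> in M. failure_end k1 (n - k1 - i) i (\<lambda>j. X j \<omega>))"
      using prob_next_successes[OF determined_by_failure_end[OF assms(1)] fe, of k1]
      unfolding len[OF i] .
    also have "\<dots> = (\<theta> * q ^ i) ^ k1 * (\<theta> ^ (n - k1 - i) *
        (\<Prod>j=1..i. 1 - \<theta> * q ^ (j - 1)) * block_gf q k1 (n - k1 - i) i)"
      by (simp only: prob_failure_end[OF assms(1)])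
    also have "(\<theta> * q ^ i) ^ k1 = \<theta> ^ k1 * q ^ (i * k1)"
      by (simp add: power_mult_distrib power_mult)
    also have "block_gf q k1 (n - k1 - i) i =
        (\<Sum>s=1..i. E_bar q k1 (n - k1 - i) i s + F_bar q k1 (n - k1 - i) i s)"
      using i assms by (simp add: block_gf_def)
    finally have "prob (?A i) = (\<theta> ^ k1 * \<theta> ^ (n - k1 - i)) * q ^ (i * k1) *
        (\<Prod>j=1..i. 1 - \<theta> * q ^ (j - 1)) *
        (\<Sum>s=1..i. E_bar q k1 (n - k1 - i) i s + F_bar q k1 (n - k1 - i) i s)"
      by (simp only: mult_ac)
    moreover have "k1 + (n - k1 - i) = n - i"
      using i assms(3) unfolding atLeastAtMost_iff by linarith
    hence "\<theta> ^ k1 * \<theta> ^ (n - k1 - i) = \<theta> ^ (n - i)"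
      by (simp only: power_add[symmetric])
    ultimately show "prob (?A i) = \<theta> ^ (n - i) * q ^ (i * k1) *
        (\<Prod>j=1..i. 1 - \<theta> * q ^ (j - 1)) *
        (\<Sum>s=1..i. E_bar q k1 (n - k1 - i) i s + F_bar q k1 (n - k1 - i) i s)"
      by simp
  qed
  finally show ?thesis .
qed

lemma P0_L_eq:
  assumes "k1 \<ge> 1" "k2 \<ge> 1" "k1 + k2 \<le> n"
  shows "P0_L M X k1 k2 n = \<theta> ^ (n - k2) * (\<Prod>j=1..k2. 1 - \<theta> * q ^ (j - 1)) *
    (\<Sum>s=1..k2. K_sum q k1 (n - k2) k2 s + L_sum q k1 (n - k2) k2 s)"
proof -
  let ?A = "\<lambda>k. {\<omega> \<in> space M. failure_end k (n - k2) k2 (\<lambda>j. X j \<omega>)}"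
  have sub: "?A k1 \<subseteq> ?A (Suc n)" using assms by (auto simp: failure_end_def run_free_def)
  have "{\<omega> \<in> space M. failure_time X k2 \<omega> = enat n \<and> success_run_time X k1 \<omega> < enat n} =
      ?A (Suc n) - ?A k1"
  proof -
    have n: "1 \<le> n" "k2 \<le> n" using assms by auto
    have "failure_time X k2 \<omega> = enat n \<and> success_run_time X k1 \<omega> < enat n \<longleftrightarrow>
        failure_end (Suc n) (n - k2) k2 (\<lambda>j. X j \<omega>) \<and> \<not> failure_end k1 (n - k2) k2 (\<lambda>j. X j \<omega>)"
      for \<omega>
      unfolding success_run_time_less_iff[OF assms(1)] failure_time_eq_iff
        failure_end_unrestricted_diff[OF assms(1) n, symmetric]
      using n(1) by blast
    thus ?thesis by blast
  qed
  hence "P0_L M X k1 k2 n = prob (?A (Suc n)) - prob (?A k1)"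
    unfolding P0_L_def using assms sub
    by (simp add: finite_measure_Diff determined_event[OF determined_by_failure_end])
  also have "\<dots> = \<theta> ^ (n - k2) * (\<Prod>j=1..k2. 1 - \<theta> * q ^ (j - 1)) *
      (block_gf q (Suc n) (n - k2) k2 - block_gf q k1 (n - k2) k2)"
    using assms by (simp add: prob_failure_end right_diff_distrib)
  also have "block_gf q (Suc n) (n - k2) k2 - block_gf q k1 (n - k2) k2 =
      (\<Sum>s=1..k2. K_sum q k1 (n - k2) k2 s + L_sum q k1 (n - k2) k2 s)"
  proof -
    have m: "1 \<le> n - k2" "n - k2 < Suc n" using assms by auto
    have "K_sum q k1 (n - k2) k2 s = E_bar q (Suc n) (n - k2) k2 s - E_bar q k1 (n - k2) k2 s"
      and "L_sum q k1 (n - k2) k2 s = F_bar q (Suc n) (n - k2) k2 s - F_bar q k1 (n - k2) k2 s"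
      for s by (rule K_sum_diff[OF assms(1) m] L_sum_diff[OF assms(1) m])+
    thus ?thesis by (simp add: block_gf_def sum_subtractf sum.distrib)
  qed
  finally show ?thesis .
qed

text \<open>
  The two waiting times never coincide, because trial \<open>n\<close> is a success if the first equals \<open>n\<close>
  and a failure if the second does.
\<close>

lemma later_time_eq:
  assumes "k1 \<ge> 1" "k2 \<ge> 1" "k1 + k2 \<le> n"
  shows "\<P>(\<omega> in M. later_time X k1 k2 \<omega> = enat n) = P1_L M X k1 k2 n + P0_L M X k1 k2 n"
proof -
  let ?A = "{\<omega> \<in> space M. success_run_time X k1 \<omega> = enat n \<and> failure_time X k2 \<omega> < enat n}"
  let ?B = "{\<omega> \<in> space M. failure_time X k2 \<omega> = enat n \<and> success_run_time X k1 \<omega> < enat n}"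
  have "\<not> (success_run_time X k1 \<omega> = enat n \<and> failure_time X k2 \<omega> = enat n)" for \<omega>
    using assms by (auto simp: success_run_time_eq_iff failure_time_eq_iff dest!: bspec[of _ _ n])
  hence "later_time X k1 k2 \<omega> = enat n \<longleftrightarrow>
      success_run_time X k1 \<omega> = enat n \<and> failure_time X k2 \<omega> < enat n \<or>
      failure_time X k2 \<omega> = enat n \<and> success_run_time X k1 \<omega> < enat n" for \<omega>
    unfolding later_time_def max_def by (metis antisym_conv2 less_le_not_le linorder_le_cases)
  hence "{\<omega> \<in> space M. later_time X k1 k2 \<omega> = enat n} = ?A \<union> ?B" by auto
  moreover have "?A \<inter> ?B = {}" by auto
  moreover have "?A \<in> events" "?B \<in> events"
  proof -
    let ?P = "\<lambda>a. (\<forall>j\<in>{n - k1 + 1..n}. a j = 1) \<and> run_free k1 (n - 1) a \<and> k2 \<le> zeros a (n - 1)"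
    let ?Q = "\<lambda>a. 1 \<le> n \<and> a n = 0 \<and> zeros a n = k2 \<and> \<not> run_free k1 (n - 1) a"
    have eq: "?P a = ?P b \<and> ?Q a = ?Q b" if ab: "\<forall>j\<in>{1..n}. a j = b j" for a b
    proof -
      have "zeros a (n - 1) = zeros b (n - 1)" "zeros a n = zeros b n"
        using ab by (auto intro!: zeros_cong)
      moreover have "run_free k1 (n - 1) a = run_free k1 (n - 1) b"
        unfolding run_free_def using ab by (intro ball_cong bex_cong) auto
      moreover have "(\<forall>j\<in>{n - k1 + 1..n}. a j = 1) = (\<forall>j\<in>{n - k1 + 1..n}. b j = 1)"
        using ab by (intro ball_cong) auto
      moreover have "a n = b n" using ab assms by auto
      ultimately show ?thesis by (simp only:)
    qed
    have "determined_by n ?P" "determined_by n ?Q"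
      unfolding determined_by_def using eq by blast+
    from this[THEN determined_event] show "?A \<in> events" "?B \<in> events"
      using assms
      by (auto simp: success_run_time_eq_iff success_run_time_less_iff failure_time_eq_iff
          failure_time_less_iff conj_assoc)
  qed
  ultimately show ?thesis
    unfolding P1_L_def P0_L_def by (simp add: finite_measure_Union)
qed

end

section \<open>The waiting time distribution\<close>

theorem theorem4p4:
  fixes M :: "'a measure" and X :: "nat \<Rightarrow> 'a \<Rightarrow> nat"
    and q \<theta> :: real and k1 k2 n :: nat
  assumes "0 \<le> \<theta>" and "\<theta> \<le> 1" and "0 < q" and "q < 1"
    and "q_bernoulli_seq M X q \<theta>"
    and "k1 \<ge> 1" and "k2 \<ge> 1" and "n \<ge> k1 + k2"
  shows "\<P>(\<omega> in M. later_time X k1 k2 \<omega> = enat n) = P1_L M X k1 k2 n + P0_L M X k1 k2 n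
    \<and> P1_L M X k1 k2 n =
        (\<Sum>i=k2..n - k1. \<theta> ^ (n - i) * q ^ (i * k1) * (\<Prod>j=1..i. 1 - \<theta> * q ^ (j - 1)) *
           (\<Sum>s=1..i. E_bar q k1 (n - k1 - i) i s + F_bar q k1 (n - k1 - i) i s))
    \<and> P0_L M X k1 k2 n =
        \<theta> ^ (n - k2) * (\<Prod>j=1..k2. 1 - \<theta> * q ^ (j - 1)) *
           (\<Sum>s=1..k2. K_sum q k1 (n - k2) k2 s + L_sum q k1 (n - k2) k2 s)"
proof -
  interpret q_bernoulli_seq M X q \<theta> by fact
  show ?thesis
    using later_time_eq P1_L_eq P0_L_eq assms(6-8) by blast
qed

end
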